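(* Let $n$ be a positive integer and $\mu\in W^{n-1,\infty}(\mathbb{D},\mathbb{B})$ such that $\|\mu\|_{W^{n-1,\infty}(\mathbb{D},\mathbb{B})}\le c<1$ for some positive real number $c$. Every solution $w:\mathbb{D}\to\mathbb{B}$ of $$(\bar\partial-\mu\,\partial)^nw=0$$ has the form $$w=\sum_{k=0}^{n-1}\widehat{(z^* )}^{\,k}\,w_k,$$ where $\bar\partial w_k=\mu\,\partial w_k$ for every $k$.
   Context: $\mathbb{D}$ is the unit disk in $\mathbb{C}$, $z=x+iy$, $z^*=x-iy$. The bicomplex numbers $\mathbb{B}=\{z_1+jz_2: z_1,z_2\in\mathbb{C}\}$ form the commutative $\mathbb{C}$-algebra with $j^2=-1$, $ij=ji$. Put $p^\pm=\frac12(1\pm ji)$. Every $w=z_1+jz_2\in\mathbb{B}$ is uniquely $w=p^+w^++p^-w^-$ with $w^\pm=z_1\mp iz_2\in\mathbb{C}$. Norm: $\|w\|_{\mathbb{B}}=\sqrt{(|w^+|^2+|w^-|^2)/2}$. For $x,y\in\mathbb{R}$ the bicomplexification of $x+iy$ is $\widehat{x+iy}=x+jy$; thus $\widehat{z^*}=x-jy$. $W^{k,\infty}(\mathbb{D},\mathbb{B})$ is the class of $f:\mathbb{D}\to\mathbb{B}$ such that $f$ and its derivatives up to order $k$ are in $L^\infty(\mathbb{D},\mathbb{B})$ (bounded with respect to $\|\cdot\|_{\mathbb{B}}$). The bicomplex operators are $\partial=\frac12(\partial_x-j\partial_y)$ and $\bar\partial=\frac12(\partial_x+j\partial_y)$.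 The $n$-th power of the operator denotes $n$-fold iteration. *)

theory Defs
  imports "HOL-Analysis.Analysis" "HOL-Probability.Essential_Supremum"
begin

section \<open>Bicomplex numbers\<close>

text \<open>\<open>Bicomplex z\<^sub>1 z\<^sub>2\<close> stands for \<open>z\<^sub>1 + j z\<^sub>2\<close>.\<close>

codatatype bicomplex = Bicomplex (bc1: complex) (bc2: complex)

lemma bicomplex_eq_iff: "x = y \<longleftrightarrow> bc1 x = bc1 y \<and> bc2 x = bc2 y"
  by (auto intro: bicomplex.expand)

instantiation bicomplex :: comm_ring_1
begin

primcorec zero_bicomplex where
  "bc1 0 = 0"
| "bc2 0 = 0"

primcorec one_bicomplex where
  "bc1 1 = 1"
| "bc2 1 = 0"

primcorec plus_bicomplex where
  "bc1 (x + y) = bc1 x + bc1 y"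
| "bc2 (x + y) = bc2 x + bc2 y"

primcorec uminus_bicomplex where
  "bc1 (- x) = - bc1 x"
| "bc2 (- x) = - bc2 x"

primcorec minus_bicomplex where
  "bc1 (x - y) = bc1 x - bc1 y"
| "bc2 (x - y) = bc2 x - bc2 y"

primcorec times_bicomplex where
  "bc1 (x * y) = bc1 x * bc1 y - bc2 x * bc2 y"
| "bc2 (x * y) = bc1 x * bc2 y + bc2 x * bc1 y"

instance
  by standard (simp_all add: bicomplex_eq_iff algebra_simps)

end

instantiation bicomplex :: real_algebra_1
begin

primcorec scaleR_bicomplex where
  "bc1 (scaleR r x) = scaleR r (bc1 x)"
| "bc2 (scaleR r x) = scaleR r (bc2 x)"

instance
  by standard (simp_all add: bicomplex_eq_iff algebra_simps)

end

definition bc_of_complex :: "complex \<Rightarrow> bicomplex" where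
  "bc_of_complex z = Bicomplex z 0"

definition bc_j :: bicomplex where
  "bc_j = Bicomplex 0 1"

definition bc_pp :: bicomplex where
  "bc_pp = (1 / 2) *\<^sub>R (1 + bc_j * bc_of_complex \<i>)"

definition bc_pm :: bicomplex where
  "bc_pm = (1 / 2) *\<^sub>R (1 - bc_j * bc_of_complex \<i>)"

text \<open>The components \<open>w\<^sup>+\<close> and \<open>w\<^sup>-\<close> with respect to the idempotents \<open>p\<^sup>+\<close> and \<open>p\<^sup>-\<close>.\<close>

definition bc_plus :: "bicomplex \<Rightarrow> complex" where
  "bc_plus w = bc1 w - \<i> * bc2 w"

definition bc_minus :: "bicomplex \<Rightarrow> complex" where
  "bc_minus w = bc1 w + \<i> * bc2 w"

lemma bicomplex_decomp:
  "w = bc_of_complex (bc1 w) + bc_j * bc_of_complex (bc2 w)"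
  by (simp add: bc_of_complex_def bc_j_def bicomplex_eq_iff)

lemma bc_j_squared: "bc_j * bc_j = - 1"
  by (simp add: bc_j_def bicomplex_eq_iff)

lemma bicomplex_idempotent_decomp:
  "w = bc_pp * bc_of_complex u + bc_pm * bc_of_complex v \<longleftrightarrow> u = bc_plus w \<and> v = bc_minus w"
proof -
  have "w = bc_pp * bc_of_complex u + bc_pm * bc_of_complex v \<longleftrightarrow>
      bc1 w = (u + v) / 2 \<and> bc2 w = \<i> * (u - v) / 2"
    by (simp add: bc_pp_def bc_pm_def bc_of_complex_def bc_j_def bicomplex_eq_iff
        scaleR_conv_of_real [where 'a = complex] field_simps)
  also have "\<dots> \<longleftrightarrow> u = bc_plus w \<and> v = bc_minus w"
  proof
    assume "bc1 w = (u + v) / 2 \<and> bc2 w = \<i> * (u - v) / 2"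
    then show "u = bc_plus w \<and> v = bc_minus w"
      by (auto simp: bc_plus_def bc_minus_def complex_eq_iff field_simps)
  next
    assume "u = bc_plus w \<and> v = bc_minus w"
    then show "bc1 w = (u + v) / 2 \<and> bc2 w = \<i> * (u - v) / 2"
      by (simp add: bc_plus_def bc_minus_def complex_eq_iff)
  qed
  finally show ?thesis .
qed

instantiation bicomplex :: real_inner
begin

definition inner_bicomplex :: "bicomplex \<Rightarrow> bicomplex \<Rightarrow> real" where
  "inner_bicomplex x y = bc1 x \<bullet> bc1 y + bc2 x \<bullet> bc2 y"

definition norm_bicomplex :: "bicomplex \<Rightarrow> real" where
  "norm_bicomplex w = sqrt (((cmod (bc_plus w))\<^sup>2 + (cmod (bc_minus w))\<^sup>2) / 2)"

definition sgn_bicomplex :: "bicomplex \<Rightarrow> bicomplex" where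
  "sgn_bicomplex x = scaleR (inverse (norm x)) x"

definition dist_bicomplex :: "bicomplex \<Rightarrow> bicomplex \<Rightarrow> real" where
  "dist_bicomplex x y = norm (x - y)"

definition uniformity_bicomplex :: "(bicomplex \<times> bicomplex) filter" where
  "uniformity_bicomplex = (INF e\<in>{0 <..}. principal {(x, y). dist x y < e})"

definition open_bicomplex :: "bicomplex set \<Rightarrow> bool" where
  "open_bicomplex U \<longleftrightarrow> (\<forall>x\<in>U. eventually (\<lambda>(x', y). x' = x \<longrightarrow> y \<in> U) uniformity)"

instance
proof
  fix x y z :: bicomplex and r :: real and U :: "bicomplex set"
  show "dist x y = norm (x - y)" by (rule dist_bicomplex_def)
  show "sgn x = scaleR (inverse (norm x)) x" by (rule sgn_bicomplex_def)
  show "uniformity = (INF e\<in>{0 <..}. principal {(x::bicomplex, y). dist x y < e})"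
    by (rule uniformity_bicomplex_def)
  show "open U \<longleftrightarrow> (\<forall>x\<in>U. eventually (\<lambda>(x', y). x' = x \<longrightarrow> y \<in> U) uniformity)"
    by (rule open_bicomplex_def)
  show "inner x y = inner y x"
    by (simp add: inner_bicomplex_def inner_commute)
  show "inner (x + y) z = inner x z + inner y z"
    by (simp add: inner_bicomplex_def inner_add_left)
  show "inner (scaleR r x) y = r * inner x y"
    by (simp add: inner_bicomplex_def distrib_left)
  show "0 \<le> inner x x"
    by (simp add: inner_bicomplex_def)
  show "inner x x = 0 \<longleftrightarrow> x = 0"
    by (simp add: inner_bicomplex_def bicomplex_eq_iff add_nonneg_eq_0_iff)
  show "norm x = sqrt (inner x x)"
  proof -
    have "(cmod (bc_plus x))\<^sup>2 + (cmod (bc_minus x))\<^sup>2 = 2 * inner x x"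
      unfolding cmod_power2 inner_bicomplex_def inner_complex_def bc_plus_def bc_minus_def
      by (simp add: power2_eq_square algebra_simps)
    then show ?thesis
      by (simp add: norm_bicomplex_def)
  qed
qed

end

instantiation bicomplex :: euclidean_space
begin

definition Basis_bicomplex :: "bicomplex set" where
  "Basis_bicomplex = {Bicomplex 1 0, Bicomplex \<i> 0, Bicomplex 0 1, Bicomplex 0 \<i>}"

instance
proof
  show "(Basis :: bicomplex set) \<noteq> {}" and "finite (Basis :: bicomplex set)"
    by (simp_all add: Basis_bicomplex_def)
next
  fix u v :: bicomplex
  assume "u \<in> Basis" and "v \<in> Basis"
  then show "u \<bullet> v = (if u = v then 1 else 0)"
    unfolding Basis_bicomplex_def by (elim insertE emptyE) (simp_all add: inner_bicomplex_def)
next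
  fix x :: bicomplex
  show "(\<forall>u\<in>Basis. x \<bullet> u = 0) \<longleftrightarrow> x = 0"
    by (auto simp: Basis_bicomplex_def inner_bicomplex_def inner_complex_def
        bicomplex_eq_iff [of x] complex_eq_iff)
qed

end

text \<open>The bicomplexification \<open>x + iy \<mapsto> x + jy\<close>.\<close>

definition bc_hat :: "complex \<Rightarrow> bicomplex" where
  "bc_hat z = of_real (Re z) + bc_j * of_real (Im z)"


section \<open>Weak derivatives on the unit disk\<close>

text \<open>Functions on the disk are total functions on \<open>\<complex>\<close> of which only the values on the
  disk are ever used.\<close>

abbreviation unit_disk :: "complex set" where
  "unit_disk \<equiv> ball 0 1"

definition partial_x :: "(complex \<Rightarrow> real) \<Rightarrow> complex \<Rightarrow> real" where
  "partial_x f z = frechet_derivative f (at z) 1"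

definition partial_y :: "(complex \<Rightarrow> real) \<Rightarrow> complex \<Rightarrow> real" where
  "partial_y f z = frechet_derivative f (at z) \<i>"

primrec Ck :: "nat \<Rightarrow> (complex \<Rightarrow> real) \<Rightarrow> bool" where
  "Ck 0 f \<longleftrightarrow> continuous_on UNIV f"
| "Ck (Suc k) f \<longleftrightarrow> (\<forall>z. f differentiable at z) \<and> Ck k (partial_x f) \<and> Ck k (partial_y f)"

definition test_functions :: "(complex \<Rightarrow> real) set" where
  "test_functions =
     {\<phi>. (\<forall>k. Ck k \<phi>) \<and> compact (closure {z. \<phi> z \<noteq> 0}) \<and> closure {z. \<phi> z \<noteq> 0} \<subseteq> unit_disk}"

definition locally_integrable :: "(complex \<Rightarrow> bicomplex) \<Rightarrow> bool" where
  "locally_integrable f \<longleftrightarrow>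
     (\<forall>K. compact K \<and> K \<subseteq> unit_disk \<longrightarrow> set_integrable lebesgue K f)"

definition has_weak_deriv ::
    "nat \<Rightarrow> nat \<Rightarrow> (complex \<Rightarrow> bicomplex) \<Rightarrow> (complex \<Rightarrow> bicomplex) \<Rightarrow> bool" where
  "has_weak_deriv a b f g \<longleftrightarrow> locally_integrable f \<and> locally_integrable g \<and>
     (\<forall>\<phi>\<in>test_functions.
        (LINT z:unit_disk|lebesgue. (partial_x ^^ a) ((partial_y ^^ b) \<phi>) z *\<^sub>R f z) =
        (-1) ^ (a + b) *\<^sub>R (LINT z:unit_disk|lebesgue. \<phi> z *\<^sub>R g z))"

text \<open>A representative of the weak derivative \<open>\<partial>\<^sub>x\<^sup>a \<partial>\<^sub>y\<^sup>b f\<close>, which is determined only up to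
  null sets; meaningful only if a weak derivative exists.\<close>

definition weak_deriv ::
    "nat \<Rightarrow> nat \<Rightarrow> (complex \<Rightarrow> bicomplex) \<Rightarrow> complex \<Rightarrow> bicomplex" where
  "weak_deriv a b f = (SOME g. has_weak_deriv a b f g)"

definition weakly_differentiable :: "(complex \<Rightarrow> bicomplex) \<Rightarrow> bool" where
  "weakly_differentiable f \<longleftrightarrow>
     (\<exists>g. has_weak_deriv 1 0 f g) \<and> (\<exists>g. has_weak_deriv 0 1 f g)"


section \<open>The Sobolev spaces \<open>W\<^sup>k\<^sup>,\<^sup>\<infinity>\<close>\<close>

definition L_infty :: "(complex \<Rightarrow> bicomplex) \<Rightarrow> bool" where
  "L_infty f \<longleftrightarrow> f \<in> borel_measurable (lebesgue_on unit_disk) \<and>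
     (\<exists>C. AE z in lebesgue_on unit_disk. norm (f z) \<le> C)"

definition W_infty :: "nat \<Rightarrow> (complex \<Rightarrow> bicomplex) \<Rightarrow> bool" where
  "W_infty k f \<longleftrightarrow> L_infty f \<and>
     (\<forall>a b. a + b \<le> k \<longrightarrow> (\<exists>g. has_weak_deriv a b f g \<and> L_infty g))"

text \<open>The maximum of the \<open>L\<^sup>\<infinity>\<close> norms of the derivatives of order at most \<open>k\<close>. Since it is bounded by
  their sum, an upper bound on it is the weaker hypothesis of the two usual normalisations.\<close>

definition W_infty_norm :: "nat \<Rightarrow> (complex \<Rightarrow> bicomplex) \<Rightarrow> ereal" where
  "W_infty_norm k f =
     (SUP (a, b) \<in> {(a, b). a + b \<le> k}.
        esssup (lebesgue_on unit_disk) (\<lambda>z. ereal (norm (weak_deriv a b f z))))"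


section \<open>The bicomplex Beltrami operator\<close>

definition bc_d :: "(complex \<Rightarrow> bicomplex) \<Rightarrow> complex \<Rightarrow> bicomplex" where
  "bc_d f z = (1 / 2) *\<^sub>R (weak_deriv 1 0 f z - bc_j * weak_deriv 0 1 f z)"

definition bc_dbar :: "(complex \<Rightarrow> bicomplex) \<Rightarrow> complex \<Rightarrow> bicomplex" where
  "bc_dbar f z = (1 / 2) *\<^sub>R (weak_deriv 1 0 f z + bc_j * weak_deriv 0 1 f z)"

definition beltrami ::
    "(complex \<Rightarrow> bicomplex) \<Rightarrow> (complex \<Rightarrow> bicomplex) \<Rightarrow> complex \<Rightarrow> bicomplex" where
  "beltrami \<mu> f z = bc_dbar f z - \<mu> z * bc_d f z"

text \<open>A solution of \<open>(\<partial>bar - \<mu> \<partial>)\<^sup>n w = 0\<close>: every iterate to which the operator is applied has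
  locally integrable weak first derivatives, and the \<open>n\<close>-th iterate vanishes almost everywhere.
  In particular every \<open>w\<close> with locally integrable weak derivatives up to order \<open>n\<close> that satisfies
  the equation is covered when \<open>\<mu>\<close> is in \<open>W\<close> of order \<open>n - 1\<close>.\<close>

definition beltrami_solution ::
    "nat \<Rightarrow> (complex \<Rightarrow> bicomplex) \<Rightarrow> (complex \<Rightarrow> bicomplex) \<Rightarrow> bool" where
  "beltrami_solution n \<mu> w \<longleftrightarrow>
     (\<forall>k<n. weakly_differentiable ((beltrami \<mu> ^^ k) w)) \<and>
     (AE z in lebesgue_on unit_disk. (beltrami \<mu> ^^ n) w z = 0)"

end

theory Submission
  imports Defs
begin

text \<open>Let \<open>Z = x - j y\<close> be the bicomplexification of \<open>z\<^sup>*\<close>. The operator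
  \<open>D = \<partial>bar - \<mu> \<partial>\<close> is a derivation with \<open>D Z = 1\<close>. Hence if \<open>D\<^sup>n w = 0\<close>, the Taylor coefficients
  \<open>w\<^sub>k = 1/k! \<Sum>m<n-k. (-Z)\<^sup>m/m! D\<^sup>k\<^sup>+\<^sup>m w\<close> satisfy \<open>D w\<^sub>k = 0\<close> by telescoping, and the Taylor formula
  \<open>w = \<Sum>k<n. Z\<^sup>k w\<^sub>k\<close> holds pointwise by the binomial theorem. The analytic content is the Leibniz rule
  for weak derivatives with a smooth factor and the almost everywhere uniqueness of weak derivatives
  (the lemma of du Bois-Reymond). For the latter, the smooth bumps built from \<open>exp (-1/t)\<close> converge
  boundedly to indicators of boxes, so the integrals over all boxes vanish.\<close>

section \<open>Smooth functions\<close>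

text \<open>The factors \<open>t\<^sup>-\<^sup>m\<close> make the family closed under differentiation, up to linear combinations.\<close>

definition exp_tail :: "nat \<Rightarrow> real \<Rightarrow> real" where
  "exp_tail m t = (if t > 0 then inverse t ^ m * exp (- inverse t) else 0)"

text \<open>From the right, the substitution \<open>s = 1/t\<close> turns the claim into the decay
  of \<open>s ^ m / exp s\<close> at infinity; from the left the function is zero.\<close>

lemma exp_tail_tendsto_0: "(exp_tail m \<longlongrightarrow> 0) (at 0)"
proof -
  have "((\<lambda>t. inverse t ^ m / exp (inverse t)) \<longlongrightarrow> (0::real)) (at_right 0)"
    using filterlim_compose[OF tendsto_power_div_exp_0 filterlim_inverse_at_top_right] .
  then have "(exp_tail m \<longlongrightarrow> 0) (at_right 0)"
    by (rule Lim_transform_eventually)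
      (auto simp: exp_tail_def eventually_at_filter exp_minus field_simps)
  moreover have "(exp_tail m \<longlongrightarrow> 0) (at_left 0)"
    by (rule tendsto_eventually) (auto simp: exp_tail_def eventually_at_filter)
  ultimately show ?thesis
    by (simp add: filterlim_at_split)
qed

lemma exp_tail_has_derivative:
  "(exp_tail m has_field_derivative exp_tail (m + 2) t - real m * exp_tail (m + 1) t) (at t)"
proof (cases t "0::real" rule: linorder_cases)
  case less
  have "(exp_tail m has_field_derivative 0) (at t)"
  proof (rule DERIV_cong_ev[THEN iffD1, OF refl _ refl])
    show "((\<lambda>_. 0) has_field_derivative 0) (at t)" by simp
    show "\<forall>\<^sub>F x in nhds t. 0 = exp_tail m x"
      using less eventually_nhds_in_open[of "{..<0}" t] by (auto elim!: eventually_mono simp: exp_tail_def)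
  qed
  with less show ?thesis by (simp add: exp_tail_def)
next
  case equal
  \<comment> \<open>As \<open>exp_tail m 0 = 0\<close>, dividing by \<open>h\<close> merely raises
    the power of \<open>1/h\<close> by one, so the previous limit gives derivative 0.\<close>
  have "\<forall>\<^sub>F h in at 0. exp_tail (Suc m) h = (exp_tail m (t + h) - exp_tail m t) / h"
    using equal by (auto simp: exp_tail_def eventually_at_filter field_simps)
  then have "(\<lambda>h. (exp_tail m (t + h) - exp_tail m t) / h) \<midarrow>0\<rightarrow> 0"
    by (rule Lim_transform_eventually[OF exp_tail_tendsto_0])
  with equal show ?thesis by (simp add: DERIV_def exp_tail_def)
next
  case greater
  have d: "((\<lambda>t. inverse t ^ m * exp (- inverse t)) has_field_derivative
      exp_tail (m + 2) t - real m * exp_tail (m + 1) t) (at t)"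
    using greater
    \<comment> \<open>Differentiating the power produces the exponent \<open>m - 1\<close>, whose
      truncated subtraction is resolved by cases on \<open>m\<close>.\<close>
    by (auto intro!: derivative_eq_intros simp: exp_tail_def) (cases m; simp add: algebra_simps)
  show ?thesis
  proof (rule DERIV_cong_ev[THEN iffD1, OF refl _ refl d])
    show "\<forall>\<^sub>F x in nhds t. inverse x ^ m * exp (- inverse x) = exp_tail m x"
      using greater eventually_nhds_in_open[of "{0<..}" t]
      by (auto elim!: eventually_mono simp: exp_tail_def)
  qed
qed

section \<open>Partial derivatives and the classes \<open>Ck\<close>\<close>

lemma partial_eqI:
  assumes "(f has_derivative F) (at z)"
  shows "partial_x f z = F 1" "partial_y f z = F \<i>"
  using frechet_derivative_at[OF assms] by (simp_all add: partial_x_def partial_y_def)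

lemma partial_const [simp]: "partial_x (\<lambda>_. c) = (\<lambda>_. 0)" "partial_y (\<lambda>_. c) = (\<lambda>_. 0)"
  by (simp_all add: partial_eqI[OF has_derivative_const] fun_eq_iff)

lemma partial_Re [simp]: "partial_x Re = (\<lambda>_. 1)" "partial_y Re = (\<lambda>_. 0)"
  and partial_Im [simp]: "partial_x Im = (\<lambda>_. 0)" "partial_y Im = (\<lambda>_. 1)"
  using partial_eqI[OF bounded_linear_imp_has_derivative[OF bounded_linear_Re]]
    partial_eqI[OF bounded_linear_imp_has_derivative[OF bounded_linear_Im]]
  by auto

lemma partial_add:
  assumes "\<forall>z. f differentiable at z" "\<forall>z. g differentiable at z"
  shows "partial_x (\<lambda>z. f z + g z) = (\<lambda>z. partial_x f z + partial_x g z)"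
    and "partial_y (\<lambda>z. f z + g z) = (\<lambda>z. partial_y f z + partial_y g z)"
  using partial_eqI[OF has_derivative_add[OF assms[THEN spec, THEN frechet_derivative_works[THEN iffD1]]]]
  by (auto simp: partial_x_def[of f] partial_x_def[of g] partial_y_def[of f] partial_y_def[of g])

lemma partial_mult:
  assumes "\<forall>z. f differentiable at z" "\<forall>z. g differentiable at z"
  shows "partial_x (\<lambda>z. f z * g z) = (\<lambda>z. f z * partial_x g z + partial_x f z * g z)"
    and "partial_y (\<lambda>z. f z * g z) = (\<lambda>z. f z * partial_y g z + partial_y f z * g z)"
  using partial_eqI[OF has_derivative_mult[OF assms[THEN spec, THEN frechet_derivative_works[THEN iffD1]]]]
  by (auto simp: partial_x_def[of f] partial_x_def[of g] partial_y_def[of f] partial_y_def[of g])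

text \<open>\<open>Ck (Suc k)\<close> does not state continuity of the function itself; at the
  bottom of the induction it comes from differentiability.\<close>

lemma Ck_Suc_imp_Ck: "Ck (Suc k) f \<Longrightarrow> Ck k f"
proof (induction k arbitrary: f)
  case 0
  then have "isCont f z" for z
    by (simp add: differentiable_imp_continuous_within)
  then show ?case
    by (simp add: continuous_at_imp_continuous_on)
next
  case (Suc k)
  from Suc.prems show ?case
    unfolding Ck.simps(2)[of "Suc k"] Ck.simps(2)[of k f] by (blast intro: Suc.IH)
qed

lemma Ck_const [intro]: "Ck k (\<lambda>_. c)"
  by (induction k arbitrary: c) simp_all

lemma Ck_coordinate [intro]: "Ck k Re" "Ck k Im"
  by (cases k; simp add: Ck_const continuous_on_Re continuous_on_Im bounded_linear_imp_differentiable
      bounded_linear_Re bounded_linear_Im)+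

lemma Ck_add: "Ck k f \<Longrightarrow> Ck k g \<Longrightarrow> Ck k (\<lambda>z. f z + g z)"
  by (induction k arbitrary: f g) (simp_all add: continuous_on_add partial_add)

lemma Ck_mult: "Ck k f \<Longrightarrow> Ck k g \<Longrightarrow> Ck k (\<lambda>z. f z * g z)"
proof (induction k arbitrary: f g)
  case 0
  then show ?case by (simp add: continuous_on_mult)
next
  case (Suc k)
  \<comment> \<open>The product rule leaves one factor undifferentiated, so the factors are also
    needed at order \<open>k\<close>.\<close>
  have "Ck k f" "Ck k g" using Suc.prems by (blast intro: Ck_Suc_imp_Ck)+
  with Suc show ?case
    by (simp add: partial_mult Ck_add)
qed

text \<open>Both partials are constant multiples of one combination of
  \<open>exp_tail (m + 2)\<close> and \<open>exp_tail (m + 1)\<close> at the same affine argument,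
  so induction with \<open>m\<close> arbitrary closes.\<close>

lemma Ck_exp_tail: "Ck k (\<lambda>z. exp_tail m (a * Re z + b * Im z + c))"
proof (induction k arbitrary: m)
  case 0
  have "continuous_on UNIV (exp_tail m)"
    using exp_tail_has_derivative by (meson DERIV_continuous continuous_at_imp_continuous_on)
  then have "continuous_on UNIV (\<lambda>z. exp_tail m (a * Re z + b * Im z + c))"
    by (rule continuous_on_compose2) (auto intro!: continuous_intros)
  then show ?case by simp
next
  case (Suc k)
  let ?L = "\<lambda>z. a * Re z + b * Im z + c"
  let ?D = "\<lambda>z. exp_tail (m + 2) (?L z) - real m * exp_tail (m + 1) (?L z)"
  have d: "((\<lambda>z. exp_tail m (?L z)) has_derivative (\<lambda>h. ?D z * (a * Re h + b * Im h))) (at z)" for z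
  proof (rule has_derivative_compose[where g = "exp_tail m" and g' = "(*) (?D z)"])
    show "(?L has_derivative (\<lambda>h. a * Re h + b * Im h)) (at z)"
      by (auto intro!: derivative_eq_intros)
    show "(exp_tail m has_derivative (*) (?D z)) (at (?L z))"
      using exp_tail_has_derivative by (rule has_field_derivative_imp_has_derivative)
  qed
  have "partial_x (\<lambda>z. exp_tail m (?L z)) = (\<lambda>z. ?D z * a)"
    and "partial_y (\<lambda>z. exp_tail m (?L z)) = (\<lambda>z. ?D z * b)"
    by (simp_all add: partial_eqI[OF d] fun_eq_iff)
  moreover have "\<forall>z. (\<lambda>z. exp_tail m (?L z)) differentiable at z"
    using d unfolding differentiable_def by blast
  moreover have "Ck k ?D"
    using Ck_add[OF Suc.IH Ck_mult[OF Ck_const Suc.IH], of "m + 2" "- real m" "m + 1"] by simp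
  ultimately show ?case
    by (simp add: Ck_mult Ck_const)
qed

section \<open>Uniqueness of weak derivatives\<close>

lemma set_integrable_continuous_scaleR:
  fixes f :: "'a::euclidean_space \<Rightarrow> 'b::{banach, second_countable_topology}"
  assumes p: "continuous_on UNIV p" and K: "compact K" and f: "set_integrable lebesgue K f"
  shows "set_integrable lebesgue K (\<lambda>z. p z *\<^sub>R f z)"
proof -
  obtain C where C: "\<And>z. z \<in> K \<Longrightarrow> \<bar>p z\<bar> \<le> C"
    using compact_continuous_image[OF continuous_on_subset[OF p] K] compact_imp_bounded[of "p ` K"]
    by (auto simp: bounded_iff)
  have [measurable]: "p \<in> borel_measurable lebesgue"
    using p by (simp add: borel_measurable_continuous_onI measurable_completion)
  from f have int: "integrable lebesgue (\<lambda>z. indicator K z *\<^sub>R f z)"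
    by (simp add: set_integrable_def)
  show ?thesis
    unfolding set_integrable_def
  proof (rule Bochner_Integration.integrable_bound)
    show "integrable lebesgue (\<lambda>z. C *\<^sub>R (indicator K z *\<^sub>R f z))"
      using int by (rule integrable_scaleR_right)
    have "(\<lambda>z. p z *\<^sub>R (indicator K z *\<^sub>R f z)) \<in> borel_measurable lebesgue"
      using int by measurable
    then show "(\<lambda>z. indicator K z *\<^sub>R (p z *\<^sub>R f z)) \<in> borel_measurable lebesgue"
      by (simp add: mult.commute)
    show "AE z in lebesgue. norm (indicator K z *\<^sub>R (p z *\<^sub>R f z)) \<le> norm (C *\<^sub>R (indicator K z *\<^sub>R f z))"
      using C by (intro AE_I2) (auto simp: indicator_def intro!: mult_right_mono order_trans[OF C])
  qed
qed

lemma locally_integrable_scaleR: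
  assumes "continuous_on UNIV p" "locally_integrable f"
  shows "locally_integrable (\<lambda>z. p z *\<^sub>R f z)"
  using assms by (auto simp: locally_integrable_def intro: set_integrable_continuous_scaleR)

lemma test_function_continuous: "\<phi> \<in> test_functions \<Longrightarrow> continuous_on UNIV \<phi>"
  unfolding test_functions_def using Ck.simps(1) by blast

text \<open>The support of \<open>\<phi>\<close> is a compact subset of the disk, where
  \<open>f\<close> is integrable and \<open>\<phi>\<close> is bounded; elsewhere the integrand is
  zero.\<close>

lemma test_function_integrable:
  assumes \<phi>: "\<phi> \<in> test_functions" and f: "locally_integrable f"
  shows "set_integrable lebesgue unit_disk (\<lambda>z. \<phi> z *\<^sub>R f z)"
proof -
  let ?K = "closure {z. \<phi> z \<noteq> 0}"
  have K: "compact ?K" "?K \<subseteq> unit_disk"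
    using \<phi> by (auto simp: test_functions_def)
  then have "set_integrable lebesgue ?K (\<lambda>z. \<phi> z *\<^sub>R f z)"
    using \<phi> f by (intro set_integrable_continuous_scaleR test_function_continuous)
      (auto simp: locally_integrable_def)
  moreover have "indicator ?K z *\<^sub>R (\<phi> z *\<^sub>R f z) = indicator unit_disk z *\<^sub>R (\<phi> z *\<^sub>R f z)" for z
    using K(2) closure_subset[of "{z. \<phi> z \<noteq> 0}"] by (cases "\<phi> z = 0") (simp_all add: indicator_def subset_iff)
  ultimately show ?thesis
    by (simp only: set_integrable_def)
qed

lemma test_functionsI:
  assumes "\<And>k. Ck k \<phi>" "compact K" "K \<subseteq> unit_disk" "\<And>z. z \<notin> K \<Longrightarrow> \<phi> z = 0"
  shows "\<phi> \<in> test_functions"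
proof -
  have "{z. \<phi> z \<noteq> 0} \<subseteq> K" using assms(4) by auto
  moreover from this have "closure {z. \<phi> z \<noteq> 0} \<subseteq> K"
    using assms(2) by (intro closure_minimal compact_imp_closed)
  ultimately show ?thesis
    using assms bounded_subset[OF compact_imp_bounded[OF assms(2)]]
    by (simp add: test_functions_def)
qed

lemma test_functions_mult:
  assumes \<phi>: "\<phi> \<in> test_functions" and p: "\<And>k. Ck k p"
  shows "(\<lambda>z. p z * \<phi> z) \<in> test_functions"
proof (rule test_functionsI)
  show "compact (closure {z. \<phi> z \<noteq> 0})" "closure {z. \<phi> z \<noteq> 0} \<subseteq> unit_disk"
    and "Ck k (\<lambda>z. p z * \<phi> z)" for k
    using \<phi> p by (simp_all add: test_functions_def Ck_mult)
  show "p z * \<phi> z = 0" if "z \<notin> closure {z. \<phi> z \<noteq> 0}" for z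
    using that closure_subset[of "{z. \<phi> z \<noteq> 0}"] by auto
qed

text \<open>Differentiation does not enlarge the support: on the open complement of the support
  \<open>\<phi>\<close> is locally constant 0.\<close>

lemma test_functions_partial:
  assumes "\<phi> \<in> test_functions"
  shows "partial_x \<phi> \<in> test_functions" "partial_y \<phi> \<in> test_functions"
proof -
  let ?S = "closure {z. \<phi> z \<noteq> 0}"
  have 0: "partial_x \<phi> z = 0 \<and> partial_y \<phi> z = 0" if "z \<notin> ?S" for z
  proof -
    have "(\<phi> has_derivative (\<lambda>_. 0)) (at z)"
    proof (rule has_derivative_transform_within_open)
      show "((\<lambda>_. 0) has_derivative (\<lambda>_. 0)) (at z)" by simp
      show "open (- ?S)" "z \<in> - ?S" using that by auto
      show "0 = \<phi> x" if "x \<in> - ?S" for x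
        using that closure_subset[of "{z. \<phi> z \<noteq> 0}"] by auto
    qed
    from partial_eqI[OF this] show ?thesis by simp
  qed
  have "compact ?S" "?S \<subseteq> unit_disk"
    and "Ck k (partial_x \<phi>)" "Ck k (partial_y \<phi>)" for k
    using assms Ck.simps(2)[of k \<phi>] unfolding test_functions_def by blast+
  then show "partial_x \<phi> \<in> test_functions" "partial_y \<phi> \<in> test_functions"
    by (simp_all add: 0 test_functionsI[where K = ?S])
qed

section \<open>Smooth bumps approximating indicators of boxes\<close>

definition box_bump :: "complex \<Rightarrow> complex \<Rightarrow> real \<Rightarrow> complex \<Rightarrow> real" where
  "box_bump a b k z =
     exp_tail 0 (k * (Re z - Re a)) * exp_tail 0 (k * (Re b - Re z)) *
     (exp_tail 0 (k * (Im z - Im a)) * exp_tail 0 (k * (Im b - Im z)))"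

lemma exp_tail_bounds: "0 \<le> exp_tail 0 t" "exp_tail 0 t \<le> 1"
  by (auto simp: exp_tail_def)

lemma box_bump_bounds: "0 \<le> box_bump a b k z" "box_bump a b k z \<le> 1"
  unfolding box_bump_def by (auto intro!: mult_nonneg_nonneg mult_le_one exp_tail_bounds)

lemma box_bump_eq_0: "k > 0 \<Longrightarrow> z \<notin> box a b \<Longrightarrow> box_bump a b k z = 0"
  by (auto simp: box_bump_def exp_tail_def in_box_complex_iff zero_less_mult_iff)

lemma box_bump_test_function:
  assumes "k > 0" "cbox a b \<subseteq> unit_disk"
  shows "box_bump a b k \<in> test_functions"
proof -
  have "Ck m (box_bump a b k)" for m
  proof -
    \<comment> \<open>Each factor is put into the affine form required by
      \<open>Ck_exp_tail\<close>.\<close>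
    have "Ck m (\<lambda>z. exp_tail 0 (k * Re z + 0 * Im z + - k * Re a) * exp_tail 0 ((- k) * Re z + 0 * Im z + k * Re b) *
     (exp_tail 0 (0 * Re z + k * Im z + - k * Im a) * exp_tail 0 (0 * Re z + (- k) * Im z + k * Im b)))"
      by (intro Ck_mult Ck_exp_tail)
    then show ?thesis
      by (simp add: box_bump_def[abs_def] algebra_simps)
  qed
  then show ?thesis
    using box_bump_eq_0[OF \<open>k > 0\<close>, of _ a b] box_subset_cbox[of a b] assms(2)
    by (intro test_functionsI[OF _ compact_cbox]) (blast intro: subsetD)+
qed

text \<open>For \<open>t > 0\<close> the exponent \<open>- 1 / (Suc j * t)\<close> tends to 0;
  otherwise every term is 0. Using \<open>Suc j\<close> keeps the scale positive, as the bump lemmas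
  require.\<close>

lemma exp_tail_scaled_tendsto:
  "(\<lambda>j. exp_tail 0 (real (Suc j) * t)) \<longlonglongrightarrow> (if t > 0 then 1 else 0)"
proof (cases "t > 0")
  case True
  have "(\<lambda>j. exp (- (inverse (real (Suc j)) * inverse t))) \<longlonglongrightarrow> exp (- (0 * inverse t))"
    by (intro tendsto_intros LIMSEQ_inverse_real_of_nat)
  with True show ?thesis
    by (simp add: exp_tail_def zero_less_mult_iff del: of_nat_Suc)
qed (simp add: exp_tail_def zero_less_mult_iff)

lemma box_bump_tendsto: "(\<lambda>j. box_bump a b (real (Suc j)) z) \<longlonglongrightarrow> indicator (box a b) z"
proof -
  have "indicator (box a b) z =
     (if Re z - Re a > 0 then 1 else 0) * (if Re b - Re z > 0 then 1 else 0) *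
     ((if Im z - Im a > 0 then 1 else 0) * (if Im b - Im z > 0 then 1 else (0::real)))"
    by (auto simp: indicator_def in_box_complex_iff)
  then show ?thesis
    unfolding box_bump_def by (simp only:) (intro tendsto_mult exp_tail_scaled_tendsto)
qed

text \<open>Dominated convergence along the bumps: they are at most 1 and vanish off the open box,
  so the norm of \<open>g\<close> on the closed box, a compact subset of the disk, is an integrable
  majorant.\<close>

lemma box_integral_eq_0:
  assumes g: "locally_integrable g" and ab: "cbox a b \<subseteq> unit_disk"
    and 0: "\<And>\<phi>. \<phi> \<in> test_functions \<Longrightarrow> (LINT z:unit_disk|lebesgue. \<phi> z *\<^sub>R g z) = 0"
  shows "(LINT z:box a b|lebesgue. g z) = 0"
proof -
  \<comment> \<open>The factor \<open>indicator unit_disk\<close> makes each integral literally one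
    that hypothesis \<open>0\<close> annihilates.\<close>
  let ?s = "\<lambda>j z. indicator unit_disk z *\<^sub>R (box_bump a b (real (Suc j)) z *\<^sub>R g z)"
  have gi: "set_integrable lebesgue (cbox a b) g"
    using g ab by (auto simp: locally_integrable_def)
  have gb: "set_integrable lebesgue (box a b) g"
    using gi by (rule set_integrable_subset) (auto intro: box_subset_cbox[THEN subsetD])
  have "(\<lambda>j. integral\<^sup>L lebesgue (?s j)) \<longlonglongrightarrow> (LINT z|lebesgue. indicator (box a b) z *\<^sub>R g z)"
  proof (rule integral_dominated_convergence)
    show "integrable lebesgue (\<lambda>z. norm (indicator (cbox a b) z *\<^sub>R g z))"
      using gi by (intro integrable_norm) (simp add: set_integrable_def)
    show "(\<lambda>z. indicator (box a b) z *\<^sub>R g z) \<in> borel_measurable lebesgue"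
      using gb by (auto simp: set_integrable_def)
    show "?s j \<in> borel_measurable lebesgue" for j
      using test_function_integrable[OF box_bump_test_function[OF _ ab] g, of "real (Suc j)"]
      by (auto simp: set_integrable_def)
    show "AE z in lebesgue. (\<lambda>j. ?s j z) \<longlonglongrightarrow> indicator (box a b) z *\<^sub>R g z"
    proof (rule AE_I2)
      fix z
      have "(\<lambda>j. ?s j z) \<longlonglongrightarrow> indicator unit_disk z *\<^sub>R (indicator (box a b) z *\<^sub>R g z)"
        by (intro tendsto_intros box_bump_tendsto)
      moreover have "indicator unit_disk z *\<^sub>R (indicator (box a b) z *\<^sub>R g z) = indicator (box a b) z *\<^sub>R g z"
        using ab box_subset_cbox[of a b] by (auto simp: indicator_def)
      ultimately show "(\<lambda>j. ?s j z) \<longlonglongrightarrow> indicator (box a b) z *\<^sub>R g z" by (simp only:)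
    qed
    show "AE z in lebesgue. norm (?s j z) \<le> norm (indicator (cbox a b) z *\<^sub>R g z)" for j
    proof (rule AE_I2)
      fix z
      show "norm (?s j z) \<le> norm (indicator (cbox a b) z *\<^sub>R g z)"
        using box_bump_eq_0[of "real (Suc j)" z a b] box_subset_cbox[of a b]
          mult_right_mono[OF box_bump_bounds(2), of "norm (g z)" a b "real (Suc j)" z]
        by (cases "z \<in> box a b") (auto simp: indicator_def box_bump_bounds)
    qed
  qed
  moreover have "integral\<^sup>L lebesgue (?s j) = 0" for j
    using 0[OF box_bump_test_function[OF _ ab]] by (simp add: set_lebesgue_integral_def)
  ultimately show ?thesis
    by (simp add: set_lebesgue_integral_def LIMSEQ_const_iff)
qed

text \<open>Boxes are an intersection-stable generator of the Borel sets, so a Dynkin argument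
  spreads the vanishing of integrals to Borel sets, and null sets then carry it to Lebesgue sets. A
  function with zero integral over every measurable set vanishes almost everywhere.\<close>

lemma AE_zero_of_box_integrals:
  fixes f :: "'a::euclidean_space \<Rightarrow> 'b::{banach, second_countable_topology}"
  assumes f: "set_integrable lebesgue (box a b) f"
    and 0: "\<And>c d. box c d \<subseteq> box a b \<Longrightarrow> (LINT z:box c d|lebesgue. f z) = 0"
  shows "AE z in lebesgue. z \<in> box a b \<longrightarrow> f z = 0"
proof -
  let ?B = "box a b"
  \<comment> \<open>Extension by zero makes the function integrable on the whole space, so
    complements and countable unions can be handled.\<close>
  define F where "F z = indicator ?B z *\<^sub>R f z" for z
  have F: "integrable lebesgue F"
    using f by (simp add: F_def[abs_def] set_integrable_def)
  have Fset: "set_integrable lebesgue A F" if "A \<in> sets lebesgue" for A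
    unfolding set_integrable_def by (rule integrable_mult_indicator[OF that F])
  have Fbox: "(LINT z:box c d|lebesgue. F z) = 0" for c d
  proof -
    obtain c' d' where eq: "box c d \<inter> ?B = box c' d'"
      using box_Int_box[of c d a b] by blast
    have "(LINT z:box c d|lebesgue. F z) = (LINT z:box c' d'|lebesgue. f z)"
      unfolding set_lebesgue_integral_def F_def eq[symmetric]
      by (intro Bochner_Integration.integral_cong) (auto simp: indicator_def)
    moreover have "box c' d' \<subseteq> ?B" unfolding eq[symmetric] by simp
    ultimately show ?thesis using 0 by simp
  qed
  \<comment> \<open>The total integral is needed for the complement step of the Dynkin
    induction.\<close>
  have F_UNIV: "(LINT z:UNIV|lebesgue. F z) = 0"
  proof -
    have "(LINT z:UNIV|lebesgue. F z) = (LINT z:?B|lebesgue. F z)"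
      unfolding set_lebesgue_integral_def F_def
      by (intro Bochner_Integration.integral_cong) (auto simp: indicator_def)
    with Fbox show ?thesis by simp
  qed
  have Fborel: "(LINT z:A|lebesgue. F z) = 0" if "A \<in> sets borel" for A
  proof -
    let ?G = "range (\<lambda>(a, b). box a b :: 'a set)"
    have stable: "Int_stable ?G"
      by (auto simp: Int_stable_def box_Int_box)
    have sets: "sigma_sets UNIV ?G = sets borel"
      by (subst borel_eq_box) (simp add: sets_measure_of)
    from that have "A \<in> sigma_sets UNIV ?G" using sets by simp
    with stable have "Int_stable ?G" "?G \<subseteq> Pow UNIV" "A \<in> sigma_sets UNIV ?G" by auto
    then show ?thesis
    proof (induction A rule: sigma_sets_induct_disjoint)
      case (basic A)
      then show ?case using Fbox by auto
    next
      case empty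
      show ?case by (simp add: set_lebesgue_integral_def)
    next
      case (compl A)
      then have "A \<in> sets borel" using sets by (simp only:)
      then have A: "A \<in> sets lebesgue" "UNIV - A \<in> sets lebesgue"
        by (simp_all add: sets.Diff)
      have "(LINT z:A \<union> (UNIV - A)|lebesgue. F z) = (LINT z:A|lebesgue. F z) + (LINT z:UNIV - A|lebesgue. F z)"
        by (intro set_integral_Un Fset A) auto
      then show ?case
        using compl.IH F_UNIV by simp
    next
      case (union A)
      then have A: "A i \<in> sets lebesgue" for i
        using sets by (intro sets_completionI_sets) auto
      have disj: "A i \<inter> A j = {}" if "i \<noteq> j" for i j
        using union.hyps(1) that by (simp add: disjoint_family_on_def)
      have "(LINT z:(\<Union>i. A i)|lebesgue. F z) = (\<Sum>i. (LINT z:(A i)|lebesgue. F z))"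
        by (rule lebesgue_integral_countable_add[OF A disj Fset]) (simp_all add: A sets.countable_UN image_subset_iff)
      then show ?case using union.IH by simp
    qed
  qed
  have "(LINT z:A|lebesgue. F z) = 0" if A: "A \<in> sets lebesgue" for A
  proof -
    \<comment> \<open>Up to a subset \<open>N\<close> of a null set \<open>N'\<close>, the Lebesgue
      set \<open>A\<close> is the Borel set \<open>S\<close>.\<close>
    obtain S N N' where A': "A = S \<union> N" "N \<subseteq> N'" "N' \<in> null_sets lborel" "S \<in> sets lborel"
      using A by (rule sets_completionE)
    have "AE z in lebesgue. z \<notin> N'"
      using A'(3) by (intro AE_not_in null_sets_completionI)
    then have eq: "AE z in lebesgue. indicator A z *\<^sub>R F z = indicator S z *\<^sub>R F z"
      by eventually_elim (use A' in \<open>auto simp: indicator_def\<close>)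
    have S: "S \<in> sets lebesgue" using A'(4) by simp
    have "(LINT z:A|lebesgue. F z) = (LINT z:S|lebesgue. F z)"
      unfolding set_lebesgue_integral_def
      by (rule integral_cong_AE[OF _ _ eq])
        (intro borel_measurable_integrable Fset[unfolded set_integrable_def] A S)+
    with Fborel A'(4) show ?thesis by simp
  qed
  note F0 = this
  have "AE z in lebesgue_on ?B. f z = 0"
  proof (rule sigma_finite_measure.density_zero)
    show "sigma_finite_measure (lebesgue_on ?B)"
      by (intro finite_measure.axioms finite_measure_lebesgue_on lmeasurable_box)
    show "integrable (lebesgue_on ?B) f"
      using f by (simp add: set_integrable_def integrable_restrict_space)
    show "(LINT z:A|lebesgue_on ?B. f z) = 0" if "A \<in> sets (lebesgue_on ?B)" for A
    proof -
      have "A \<in> sets lebesgue"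
        using that by (simp add: sets_restrict_space_iff)
      moreover have "(LINT z:A|lebesgue_on ?B. f z) = (LINT z:A|lebesgue. F z)"
        by (simp add: set_lebesgue_integral_def integral_restrict_space F_def[abs_def] mult.commute)
      ultimately show ?thesis by (simp only: F0)
    qed
  qed
  then show ?thesis
    by (simp add: AE_restrict_space_iff)
qed

text \<open>This is the du Bois-Reymond lemma. The disk is a countable union of closed boxes, so the
  exceptional null sets of the boxes can be united.\<close>

lemma AE_zero_on_disk:
  assumes g: "locally_integrable g"
    and 0: "\<And>\<phi>. \<phi> \<in> test_functions \<Longrightarrow> (LINT z:unit_disk|lebesgue. \<phi> z *\<^sub>R g z) = 0"
  shows "AE z in lebesgue_on unit_disk. g z = 0"
proof -
  obtain \<D> :: "complex set set" where \<D>: "countable \<D>" "\<D> \<subseteq> Pow unit_disk"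
      "\<And>X. X \<in> \<D> \<Longrightarrow> \<exists>a b. X = cbox a b" "\<Union>\<D> = unit_disk"
    using open_countable_Union_open_cbox[OF open_ball] by metis
  have "AE z in lebesgue. z \<in> X \<longrightarrow> g z = 0" if X_in: "X \<in> \<D>" for X
  proof -
    obtain a b where X: "X = cbox a b" using \<D>(3)[OF X_in] by blast
    then have ab: "cbox a b \<subseteq> unit_disk" using \<D>(2) X_in by blast
    have "AE z in lebesgue. z \<in> box a b \<longrightarrow> g z = 0"
    proof (rule AE_zero_of_box_integrals)
      have "set_integrable lebesgue (cbox a b) g"
        using g ab by (simp add: locally_integrable_def)
      then show "set_integrable lebesgue (box a b) g"
        by (rule set_integrable_subset) (simp_all add: box_subset_cbox)
      show "(LINT z:box c d|lebesgue. g z) = 0" if sub: "box c d \<subseteq> box a b" for c d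
      \<comment> \<open>If the open box is empty, \<open>cbox c d\<close> may be degenerate and
        leave the disk, so only the nonempty case may pass to closures.\<close>
      proof (cases "box c d = {}")
        case False
        then have "cbox c d = closure (box c d)" by (simp add: closure_box)
        also have "\<dots> \<subseteq> cbox a b"
          using sub box_subset_cbox[of a b] by (intro closure_minimal closed_cbox) blast
        finally show ?thesis
          using g 0 ab by (intro box_integral_eq_0) auto
      qed (simp add: set_lebesgue_integral_def)
    qed
    \<comment> \<open>The boundary of the box is negligible.\<close>
    moreover have "AE z in lebesgue. z \<notin> cbox a b - box a b"
      by (intro AE_not_in) (simp only: negligible_iff_null_sets[symmetric] negligible_frontier_interval)
    ultimately show ?thesis
      unfolding X by eventually_elim auto
  qed
  then have "AE z in lebesgue. \<forall>X\<in>\<D>. z \<in> X \<longrightarrow> g z = 0"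
    using \<D>(1) by (subst AE_ball_countable) auto
  then have "AE z in lebesgue. z \<in> unit_disk \<longrightarrow> g z = 0"
    unfolding \<D>(4)[symmetric] by eventually_elim blast
  then show ?thesis
    by (simp add: AE_restrict_space_iff)
qed

section \<open>Calculus of weak derivatives\<close>

lemma locally_integrable_add:
  assumes "locally_integrable f" "locally_integrable g"
  shows "locally_integrable (\<lambda>z. f z + g z)"
  using assms by (simp add: locally_integrable_def set_integral_add)

lemma set_integrable_bounded_linear:
  fixes f :: "'a \<Rightarrow> 'b::{banach, second_countable_topology}"
    and T :: "'b \<Rightarrow> 'c::{banach, second_countable_topology}"
  assumes T: "bounded_linear T" and f: "set_integrable M A f"
  shows "set_integrable M A (\<lambda>z. T (f z))"
    and "(LINT z:A|M. T (f z)) = T (LINT z:A|M. f z)"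
proof -
  have eq: "indicator A z *\<^sub>R T (f z) = T (indicator A z *\<^sub>R f z)" for z
    using T by (simp add: linear_simps(5))
  show "set_integrable M A (\<lambda>z. T (f z))"
    unfolding set_integrable_def eq
    using integrable_bounded_linear[OF T f[unfolded set_integrable_def]] .
  show "(LINT z:A|M. T (f z)) = T (LINT z:A|M. f z)"
    unfolding set_lebesgue_integral_def eq
    using integral_bounded_linear[OF T f[unfolded set_integrable_def]] .
qed

lemma locally_integrable_bounded_linear:
  "bounded_linear T \<Longrightarrow> locally_integrable f \<Longrightarrow> locally_integrable (\<lambda>z. T (f z))"
  by (simp add: locally_integrable_def set_integrable_bounded_linear)

lemma test_functions_iterated_partial:
  "\<phi> \<in> test_functions \<Longrightarrow> (partial_x ^^ a) ((partial_y ^^ b) \<phi>) \<in> test_functions"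
proof -
  have y: "(partial_y ^^ b) \<phi> \<in> test_functions" if "\<phi> \<in> test_functions" for \<phi> b
    using that by (induction b) (simp_all add: test_functions_partial)
  have "(partial_x ^^ a) \<phi> \<in> test_functions" if "\<phi> \<in> test_functions" for \<phi>
    using that by (induction a) (simp_all add: test_functions_partial)
  then show "\<phi> \<in> test_functions \<Longrightarrow> (partial_x ^^ a) ((partial_y ^^ b) \<phi>) \<in> test_functions"
    using y by blast
qed

lemma has_weak_deriv_locally_integrable:
  "has_weak_deriv a b f g \<Longrightarrow> locally_integrable f"
  "has_weak_deriv a b f g \<Longrightarrow> locally_integrable g"
  by (simp_all add: has_weak_deriv_def)

lemma has_weak_deriv_0: "has_weak_deriv a b (\<lambda>_. 0) (\<lambda>_. 0)"
  by (simp add: has_weak_deriv_def locally_integrable_def)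

lemma has_weak_deriv_add:
  assumes "has_weak_deriv a b f g" "has_weak_deriv a b f' g'"
  shows "has_weak_deriv a b (\<lambda>z. f z + f' z) (\<lambda>z. g z + g' z)"
  using assms
  by (simp add: has_weak_deriv_def locally_integrable_add scaleR_add_right set_integral_add
      test_function_integrable test_functions_iterated_partial)

text \<open>\<open>T\<close> commutes with the integral and with the real factors
  \<open>\<phi> z\<close>. It is applied to real scaling and to multiplication by a bicomplex
  constant.\<close>

lemma has_weak_deriv_bounded_linear:
  assumes T: "bounded_linear T" and f: "has_weak_deriv a b f g"
  shows "has_weak_deriv a b (\<lambda>z. T (f z)) (\<lambda>z. T (g z))"
proof -
  have eq: "(LINT z:unit_disk|lebesgue. \<psi> z *\<^sub>R T (h z)) = T (LINT z:unit_disk|lebesgue. \<psi> z *\<^sub>R h z)"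
    if "\<psi> \<in> test_functions" "locally_integrable h" for \<psi> h
    using set_integrable_bounded_linear(2)[OF T test_function_integrable[OF that]] T
    by (simp add: linear_simps(5))
  show ?thesis
    using f T
    by (simp add: has_weak_deriv_def locally_integrable_bounded_linear eq
        test_functions_iterated_partial linear_simps(5))
qed

text \<open>\<open>p * \<phi>\<close> is again a test function. Testing \<open>f\<close> against it
  and applying the classical product rule to \<open>p * \<phi>\<close> yields the weak Leibniz
  rule.\<close>

lemma has_weak_deriv_scaleR_smooth:
  assumes p: "\<And>k. Ck k p"
  shows "has_weak_deriv 1 0 f g \<Longrightarrow>
      has_weak_deriv 1 0 (\<lambda>z. p z *\<^sub>R f z) (\<lambda>z. p z *\<^sub>R g z + partial_x p z *\<^sub>R f z)"
    and "has_weak_deriv 0 1 f g \<Longrightarrow>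
      has_weak_deriv 0 1 (\<lambda>z. p z *\<^sub>R f z) (\<lambda>z. p z *\<^sub>R g z + partial_y p z *\<^sub>R f z)"
proof -
  have c: "continuous_on UNIV p" "continuous_on UNIV (partial_x p)" "continuous_on UNIV (partial_y p)"
    and dp: "\<forall>z. p differentiable at z"
    and dCk: "Ck k (partial_x p)" "Ck k (partial_y p)" for k
    using p[of 0] p[of "Suc 0"] p[of "Suc k"] by simp_all
  \<comment> \<open>One computation serves both directions: \<open>\<psi>\<close> and
    \<open>q\<close> stand for the derivatives of \<open>\<phi>\<close> and \<open>p\<close> in the
    same direction.\<close>
  have Leibniz: "(LINT z:unit_disk|lebesgue. \<psi> z *\<^sub>R (p z *\<^sub>R f z)) =
      - (LINT z:unit_disk|lebesgue. \<phi> z *\<^sub>R (p z *\<^sub>R g z + q z *\<^sub>R f z))"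
    if "locally_integrable f" "locally_integrable g"
      and \<phi>: "\<phi> \<in> test_functions" "\<psi> \<in> test_functions" and q: "\<And>k. Ck k q"
      and ibp: "(LINT z:unit_disk|lebesgue. (p z * \<psi> z + q z * \<phi> z) *\<^sub>R f z) =
         - (LINT z:unit_disk|lebesgue. (p z * \<phi> z) *\<^sub>R g z)" for \<phi> \<psi> f g q
  proof -
    note int = test_function_integrable[OF test_functions_mult[OF \<phi>(1) p] that(2)]
      test_function_integrable[OF test_functions_mult[OF \<phi>(2) p] that(1)]
      test_function_integrable[OF test_functions_mult[OF \<phi>(1) q] that(1)]
    show ?thesis
      using ibp int
      by (simp add: scaleR_add_left scaleR_add_right set_integral_add mult.commute)
        (simp add: eq_diff_eq)
  qed
  show "has_weak_deriv 1 0 (\<lambda>z. p z *\<^sub>R f z) (\<lambda>z. p z *\<^sub>R g z + partial_x p z *\<^sub>R f z)"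
    if fg: "has_weak_deriv 1 0 f g"
    unfolding has_weak_deriv_def
  proof (intro conjI ballI)
    note li = has_weak_deriv_locally_integrable[OF fg]
    show "locally_integrable (\<lambda>z. p z *\<^sub>R f z)"
      and "locally_integrable (\<lambda>z. p z *\<^sub>R g z + partial_x p z *\<^sub>R f z)"
      using li c by (simp_all add: locally_integrable_add locally_integrable_scaleR)
    fix \<phi> assume \<phi>: "\<phi> \<in> test_functions"
    then have "\<forall>z. \<phi> differentiable at z"
      unfolding test_functions_def using Ck.simps(2) by blast
    with fg dp test_functions_mult[OF \<phi> p]
    have "(LINT z:unit_disk|lebesgue. (p z * partial_x \<phi> z + partial_x p z * \<phi> z) *\<^sub>R f z) =
         - (LINT z:unit_disk|lebesgue. (p z * \<phi> z) *\<^sub>R g z)"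
      by (auto simp: has_weak_deriv_def partial_mult)
    from Leibniz[OF li \<phi> test_functions_partial(1)[OF \<phi>] dCk(1) this]
    show "(LINT z:unit_disk|lebesgue. (partial_x ^^ 1) ((partial_y ^^ 0) \<phi>) z *\<^sub>R p z *\<^sub>R f z) =
         (- 1) ^ (1 + 0) *\<^sub>R (LINT z:unit_disk|lebesgue. \<phi> z *\<^sub>R (p z *\<^sub>R g z + partial_x p z *\<^sub>R f z))"
      by simp
  qed
  show "has_weak_deriv 0 1 (\<lambda>z. p z *\<^sub>R f z) (\<lambda>z. p z *\<^sub>R g z + partial_y p z *\<^sub>R f z)"
    if fg: "has_weak_deriv 0 1 f g"
    unfolding has_weak_deriv_def
  proof (intro conjI ballI)
    note li = has_weak_deriv_locally_integrable[OF fg]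
    show "locally_integrable (\<lambda>z. p z *\<^sub>R f z)"
      and "locally_integrable (\<lambda>z. p z *\<^sub>R g z + partial_y p z *\<^sub>R f z)"
      using li c by (simp_all add: locally_integrable_add locally_integrable_scaleR)
    fix \<phi> assume \<phi>: "\<phi> \<in> test_functions"
    then have "\<forall>z. \<phi> differentiable at z"
      unfolding test_functions_def using Ck.simps(2) by blast
    with fg dp test_functions_mult[OF \<phi> p]
    have "(LINT z:unit_disk|lebesgue. (p z * partial_y \<phi> z + partial_y p z * \<phi> z) *\<^sub>R f z) =
         - (LINT z:unit_disk|lebesgue. (p z * \<phi> z) *\<^sub>R g z)"
      by (auto simp: has_weak_deriv_def partial_mult)
    from Leibniz[OF li \<phi> test_functions_partial(2)[OF \<phi>] dCk(2) this]
    show "(LINT z:unit_disk|lebesgue. (partial_x ^^ 0) ((partial_y ^^ 1) \<phi>) z *\<^sub>R p z *\<^sub>R f z) =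
         (- 1) ^ (0 + 1) *\<^sub>R (LINT z:unit_disk|lebesgue. \<phi> z *\<^sub>R (p z *\<^sub>R g z + partial_y p z *\<^sub>R f z))"
      by simp
  qed
qed

text \<open>The chosen representative and \<open>g\<close> satisfy the same defining identity, so
  their difference integrates to zero against every test function.\<close>

lemma weak_deriv_AE:
  assumes "has_weak_deriv a b f g"
  shows "AE z in lebesgue_on unit_disk. weak_deriv a b f z = g z"
proof -
  let ?h = "weak_deriv a b f"
  have h: "has_weak_deriv a b f ?h"
    unfolding weak_deriv_def by (rule someI[of "has_weak_deriv a b f", OF assms])
  have minus: "bounded_linear (\<lambda>w::bicomplex. - w)"
    by (intro bounded_linear_minus bounded_linear_ident)
  note li = assms[THEN has_weak_deriv_locally_integrable(2)] h[THEN has_weak_deriv_locally_integrable(2)]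
  have "AE z in lebesgue_on unit_disk. ?h z + - g z = 0"
  proof (rule AE_zero_on_disk)
    show "locally_integrable (\<lambda>z. ?h z + - g z)"
      using li by (intro locally_integrable_add locally_integrable_bounded_linear[OF minus])
    fix \<phi> assume \<phi>: "\<phi> \<in> test_functions"
    have "(LINT z:unit_disk|lebesgue. (partial_x ^^ a) ((partial_y ^^ b) \<phi>) z *\<^sub>R f z) =
        (- 1) ^ (a + b) *\<^sub>R (LINT z:unit_disk|lebesgue. \<phi> z *\<^sub>R u z)"
      if "has_weak_deriv a b f u" for u
      using that \<phi> unfolding has_weak_deriv_def by blast
    from this[OF h] this[OF assms]
    have "(LINT z:unit_disk|lebesgue. \<phi> z *\<^sub>R ?h z) = (LINT z:unit_disk|lebesgue. \<phi> z *\<^sub>R g z)"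
      by simp
    then show "(LINT z:unit_disk|lebesgue. \<phi> z *\<^sub>R (?h z + - g z)) = 0"
      using li[THEN test_function_integrable[OF \<phi>]]
      by (simp add: scaleR_diff_right set_integral_diff)
  qed
  then show ?thesis by simp
qed

text \<open>In finite dimension, linearity implies boundedness.\<close>

lemma bounded_linear_bc_mult: "bounded_linear (\<lambda>w. a * w :: bicomplex)"
  by (simp add: linear_conv_bounded_linear[symmetric] linear_iff distrib_left)

text \<open>This splits multiplication by \<open>Z\<close> into smooth real factors and constant
  linear maps, the two operations for which weak derivative rules are available.\<close>

lemma bc_hat_cnj_mult:
  "bc_hat (cnj z) * w = Re z *\<^sub>R w + Im z *\<^sub>R (- bc_j * w)"
  by (simp add: bc_hat_def algebra_simps of_real_def)

section \<open>The Beltrami operator as a derivation\<close>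

text \<open>The operator at a point where \<open>\<mu>\<close> is \<open>m\<close> and the partial derivatives are \<open>u\<close> and \<open>v\<close>.\<close>

definition beltrami_form :: "bicomplex \<Rightarrow> bicomplex \<Rightarrow> bicomplex \<Rightarrow> bicomplex" where
  "beltrami_form m u v = (1/2) *\<^sub>R (u + bc_j * v) - m * ((1/2) *\<^sub>R (u - bc_j * v))"

lemma beltrami_form_linear:
  "beltrami_form m (u + u') (v + v') = beltrami_form m u v + beltrami_form m u' v'"
  "beltrami_form m (c *\<^sub>R u) (c *\<^sub>R v) = c *\<^sub>R beltrami_form m u v"
  "beltrami_form m (w * u) (w * v) = w * beltrami_form m u v"
  by (simp_all add: beltrami_form_def algebra_simps)

text \<open>The arguments \<open>1\<close> and \<open>- bc_j\<close> are the partials of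
  \<open>Z = x - j y\<close>, so this says \<open>D Z = 1\<close> for every value of
  \<open>\<mu>\<close>.\<close>

lemma beltrami_form_bc_hat_cnj: "beltrami_form m 1 (- bc_j) = 1"
  using scaleR_half_double[of "1::bicomplex"] by (simp add: beltrami_form_def bc_j_squared)

text \<open>\<open>beltrami\<close> is computed from chosen representatives, so its algebraic rules
  hold only almost everywhere; a relation records its value up to null sets.\<close>

definition has_beltrami ::
    "(complex \<Rightarrow> bicomplex) \<Rightarrow> (complex \<Rightarrow> bicomplex) \<Rightarrow> (complex \<Rightarrow> bicomplex) \<Rightarrow> bool" where
  "has_beltrami \<mu> f F \<longleftrightarrow>
     weakly_differentiable f \<and> (AE z in lebesgue_on unit_disk. beltrami \<mu> f z = F z)"

lemma beltrami_AE:
  assumes "has_weak_deriv 1 0 f g" "has_weak_deriv 0 1 f h"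
  shows "AE z in lebesgue_on unit_disk. beltrami \<mu> f z =
    beltrami_form (\<mu> z) (g z) (h z)"
  using assms[THEN weak_deriv_AE]
  by eventually_elim (simp add: beltrami_def bc_d_def bc_dbar_def beltrami_form_def)

lemma has_beltramiE:
  assumes "has_beltrami \<mu> f F"
  obtains g h where "has_weak_deriv 1 0 f g" "has_weak_deriv 0 1 f h"
    "AE z in lebesgue_on unit_disk. F z =
      beltrami_form (\<mu> z) (g z) (h z)"
proof -
  obtain g h where gh: "has_weak_deriv 1 0 f g" "has_weak_deriv 0 1 f h"
    using assms by (auto simp: has_beltrami_def weakly_differentiable_def)
  moreover have "AE z in lebesgue_on unit_disk. F z =
      beltrami_form (\<mu> z) (g z) (h z)"
    using assms[unfolded has_beltrami_def, THEN conjunct2] beltrami_AE[OF gh, of \<mu>]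
    by eventually_elim simp
  ultimately show thesis by (rule that)
qed

lemma has_beltramiI:
  assumes "has_weak_deriv 1 0 f g" "has_weak_deriv 0 1 f h"
    "AE z in lebesgue_on unit_disk. F z =
      beltrami_form (\<mu> z) (g z) (h z)"
  shows "has_beltrami \<mu> f F"
proof -
  have "AE z in lebesgue_on unit_disk. beltrami \<mu> f z = F z"
    using assms(3) beltrami_AE[OF assms(1,2), of \<mu>] by eventually_elim simp
  with assms(1,2) show ?thesis
    by (auto simp: has_beltrami_def weakly_differentiable_def)
qed

lemma has_beltrami_0: "has_beltrami \<mu> (\<lambda>_. 0) (\<lambda>_. 0)"
  by (rule has_beltramiI[OF has_weak_deriv_0 has_weak_deriv_0]) (simp add: beltrami_form_def)

lemma has_beltrami_add:
  assumes "has_beltrami \<mu> f F" "has_beltrami \<mu> f' F'"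
  shows "has_beltrami \<mu> (\<lambda>z. f z + f' z) (\<lambda>z. F z + F' z)"
proof -
  from assms(1) obtain g h where 1: "has_weak_deriv 1 0 f g" "has_weak_deriv 0 1 f h"
    "AE z in lebesgue_on unit_disk. F z =
      beltrami_form (\<mu> z) (g z) (h z)"
    by (rule has_beltramiE)
  from assms(2) obtain g' h' where 2: "has_weak_deriv 1 0 f' g'" "has_weak_deriv 0 1 f' h'"
    "AE z in lebesgue_on unit_disk. F' z =
      beltrami_form (\<mu> z) (g' z) (h' z)"
    by (rule has_beltramiE)
  show ?thesis
  proof (rule has_beltramiI[OF has_weak_deriv_add[OF 1(1) 2(1)] has_weak_deriv_add[OF 1(2) 2(2)]])
    show "AE z in lebesgue_on unit_disk. F z + F' z =
      beltrami_form (\<mu> z) (g z + g' z) (h z + h' z)"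
      using 1(3) 2(3) by eventually_elim (simp add: beltrami_form_linear)
  qed
qed

lemma has_beltrami_scaleR:
  assumes "has_beltrami \<mu> f F"
  shows "has_beltrami \<mu> (\<lambda>z. c *\<^sub>R f z) (\<lambda>z. c *\<^sub>R F z)"
proof -
  from assms obtain g h where 1: "has_weak_deriv 1 0 f g" "has_weak_deriv 0 1 f h"
    "AE z in lebesgue_on unit_disk. F z =
      beltrami_form (\<mu> z) (g z) (h z)"
    by (rule has_beltramiE)
  note lin = has_weak_deriv_bounded_linear[OF bounded_linear_scaleR_right[of c]]
  show ?thesis
  proof (rule has_beltramiI[OF lin[OF 1(1)] lin[OF 1(2)]])
    show "AE z in lebesgue_on unit_disk. c *\<^sub>R F z =
      beltrami_form (\<mu> z) (c *\<^sub>R g z) (c *\<^sub>R h z)"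
      using 1(3) by eventually_elim (simp add: beltrami_form_linear)
  qed
qed

text \<open>The derivation rule \<open>D (Z f) = (D Z) f + Z (D f)\<close> with
  \<open>D Z = 1\<close>.\<close>

lemma has_beltrami_mult_bc_hat_cnj:
  assumes "has_beltrami \<mu> f F"
  shows "has_beltrami \<mu> (\<lambda>z. bc_hat (cnj z) * f z) (\<lambda>z. f z + bc_hat (cnj z) * F z)"
proof -
  from assms obtain g h where 1: "has_weak_deriv 1 0 f g" "has_weak_deriv 0 1 f h"
    "AE z in lebesgue_on unit_disk. F z =
      beltrami_form (\<mu> z) (g z) (h z)"
    by (rule has_beltramiE)
  note lin = has_weak_deriv_bounded_linear[OF bounded_linear_bc_mult[of "- bc_j"]]
  note prod = has_weak_deriv_scaleR_smooth[where p = Re, OF Ck_coordinate(1)]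
    has_weak_deriv_scaleR_smooth[where p = Im, OF Ck_coordinate(2)]
  have x: "has_weak_deriv 1 0 (\<lambda>z. bc_hat (cnj z) * f z) (\<lambda>z. bc_hat (cnj z) * g z + f z)"
    using has_weak_deriv_add[OF prod(1)[OF 1(1)] prod(3)[OF lin[OF 1(1)]]]
    by (simp only: bc_hat_cnj_mult) (simp add: algebra_simps)
  have y: "has_weak_deriv 0 1 (\<lambda>z. bc_hat (cnj z) * f z) (\<lambda>z. bc_hat (cnj z) * h z - bc_j * f z)"
    using has_weak_deriv_add[OF prod(2)[OF 1(2)] prod(4)[OF lin[OF 1(2)]]]
    by (simp only: bc_hat_cnj_mult) (simp add: algebra_simps)
  show ?thesis
  proof (rule has_beltramiI[OF x y])
    have eq: "beltrami_form (\<mu> z) (bc_hat (cnj z) * g z + f z) (bc_hat (cnj z) * h z - bc_j * f z) =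
        f z + bc_hat (cnj z) * beltrami_form (\<mu> z) (g z) (h z)" for z
      \<comment> \<open>Writing the remainders as \<open>f z * 1\<close> and
        \<open>f z * - bc_j\<close> exposes the partials of \<open>Z\<close>, on which the form
        equals 1.\<close>
      using beltrami_form_linear(1)[of "\<mu> z" "bc_hat (cnj z) * g z" "f z * 1"
          "bc_hat (cnj z) * h z" "f z * - bc_j"]
      unfolding beltrami_form_linear(3) beltrami_form_bc_hat_cnj by (simp add: mult.commute)
    show "AE z in lebesgue_on unit_disk. f z + bc_hat (cnj z) * F z =
        beltrami_form (\<mu> z) (bc_hat (cnj z) * g z + f z) (bc_hat (cnj z) * h z - bc_j * f z)"
      using 1(3) by eventually_elim (simp add: eq)
  qed
qed

text \<open>Iterating the derivation rule. At \<open>m = 0\<close> the truncated exponent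
  \<open>m - 1\<close> is harmless because \<open>of_nat m\<close> is zero.\<close>

lemma has_beltrami_mult_bc_hat_cnj_power:
  assumes "has_beltrami \<mu> f F"
  shows "has_beltrami \<mu> (\<lambda>z. bc_hat (cnj z) ^ m * f z)
    (\<lambda>z. of_nat m * bc_hat (cnj z) ^ (m - 1) * f z + bc_hat (cnj z) ^ m * F z)"
proof (induction m)
  case 0
  with assms show ?case by simp
next
  case (Suc m)
  have "bc_hat (cnj z) ^ m * f z + bc_hat (cnj z) *
      (of_nat m * bc_hat (cnj z) ^ (m - 1) * f z + bc_hat (cnj z) ^ m * F z) =
      of_nat (Suc m) * bc_hat (cnj z) ^ m * f z + bc_hat (cnj z) ^ Suc m * F z" for z
    by (cases m) (simp_all add: algebra_simps)
  with has_beltrami_mult_bc_hat_cnj[OF Suc] show ?case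
    by (simp add: mult.assoc)
qed

lemma has_beltrami_sum:
  assumes "\<And>i. i < (N::nat) \<Longrightarrow> has_beltrami \<mu> (f i) (F i)"
  shows "has_beltrami \<mu> (\<lambda>z. \<Sum>i<N. f i z) (\<lambda>z. \<Sum>i<N. F i z)"
  using assms by (induction N) (simp_all add: has_beltrami_0 has_beltrami_add)

section \<open>Taylor expansion in the conjugate variable\<close>

text \<open>This is the binomial expansion of \<open>(1 - 1) ^ l\<close> divided by
  \<open>fact l\<close>.\<close>

lemma alternating_inverse_fact_sum:
  "(\<Sum>i\<le>l. (1 / fact i) * ((-1) ^ (l - i) / fact (l - i))) = (if l = 0 then 1 else (0::real))"
proof -
  have "(\<Sum>i\<le>l. (1 / fact i) * ((-1) ^ (l - i) / fact (l - i))) =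
      (\<Sum>i\<le>l. real (l choose i) * 1 ^ i * (-1) ^ (l - i)) / fact l"
    by (simp add: sum_divide_distrib binomial_fact)
  also have "\<dots> = (1 + (-1)) ^ l / fact l"
    by (simp only: binomial_ring)
  also have "\<dots> = (if l = 0 then 1 else 0)"
    by simp
  finally show ?thesis .
qed

text \<open>With \<open>G m\<close> as the \<open>m\<close>-th iterate, the part of term
  \<open>m + 1\<close> that differentiates the power of \<open>Z\<close> cancels the part of term
  \<open>m\<close> that raises the order of \<open>G\<close>. Only the top term survives.\<close>

lemma taylor_coefficients_telescope:
  fixes Z :: "'a::real_algebra_1"
  shows "(\<Sum>m<Suc N. ((-1) ^ m / fact m) *\<^sub>R (of_nat m * Z ^ (m - 1) * G m + Z ^ m * G (Suc m))) =
    ((-1) ^ N / fact N) *\<^sub>R (Z ^ N * G (Suc N))"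
proof (induction N)
  case (Suc N)
  have "of_nat (Suc N) * Z ^ N * G (Suc N) = real (Suc N) *\<^sub>R (Z ^ N * G (Suc N))"
    by (simp add: scaleR_conv_of_real mult.assoc)
  then have "((-1) ^ Suc N / fact (Suc N)) *\<^sub>R (of_nat (Suc N) * Z ^ N * G (Suc N)) =
      ((-1) ^ Suc N / fact (Suc N) * real (Suc N)) *\<^sub>R (Z ^ N * G (Suc N))"
    by (simp only: scaleR_scaleR)
  \<comment> \<open>The factor \<open>Suc N\<close> from the derivative lowers the factorial,
    leaving the previous coefficient with opposite sign.\<close>
  also have "(-1) ^ Suc N / fact (Suc N) * real (Suc N) = - ((-1) ^ N / fact N)"
    by (simp add: fact_Suc del: of_nat_Suc)
  finally have eq: "((-1) ^ Suc N / fact (Suc N)) *\<^sub>R (of_nat (Suc N) * Z ^ N * G (Suc N)) =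
      - (((-1) ^ N / fact N) *\<^sub>R (Z ^ N * G (Suc N)))"
    by (simp only: scaleR_minus_left)
  show ?case
    unfolding sum.lessThan_Suc[of _ "Suc N"] Suc.IH
    unfolding scaleR_add_right diff_Suc_1 eq by simp
qed simp

text \<open>Collecting terms along \<open>l = k + m\<close>, the coefficient of
  \<open>Z ^ l * G l\<close> is the alternating sum above, which is zero unless
  \<open>l = 0\<close>; \<open>n > 0\<close> ensures that this index occurs.\<close>

lemma taylor_reconstruction:
  fixes Z :: "'a::real_algebra_1"
  assumes "n > 0"
  shows "(\<Sum>k<n. Z ^ k * ((1 / fact k) *\<^sub>R (\<Sum>m<n - k. ((-1) ^ m / fact m) *\<^sub>R (Z ^ m * G (k + m))))) = G 0"
proof -
  define g where "g k m = ((1 / fact k) * ((-1) ^ m / fact m)) *\<^sub>R (Z ^ (k + m) * G (k + m))" for k m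
  have "(\<Sum>k<n. Z ^ k * ((1 / fact k) *\<^sub>R (\<Sum>m<n - k. ((-1) ^ m / fact m) *\<^sub>R (Z ^ m * G (k + m))))) =
      (\<Sum>k<n. \<Sum>m<n - k. g k m)"
    by (simp add: g_def scaleR_sum_right sum_distrib_left power_add mult.assoc)
  also have "\<dots> = (\<Sum>(k, m)\<in>{(k, m). k + m < n}. g k m)"
    by (subst sum.Sigma) (auto intro!: sum.cong)
  also have "\<dots> = (\<Sum>l<n. \<Sum>k\<le>l. g k (l - k))"
    by (rule sum.triangle_reindex)
  also have "\<dots> = (\<Sum>l<n. (if l = 0 then 1 else 0) *\<^sub>R (Z ^ l * G l))"
    by (intro sum.cong refl)
      (simp add: g_def alternating_inverse_fact_sum[symmetric] scaleR_sum_left del: times_divide_eq_left)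
  also have "\<dots> = G 0"
    using assms by (simp add: if_distrib[of "\<lambda>r. r *\<^sub>R _"] sum.delta cong: if_cong)
  finally show ?thesis .
qed

theorem theorem3p14:
  fixes n :: nat and \<mu> :: "complex \<Rightarrow> bicomplex" and c :: real and w :: "complex \<Rightarrow> bicomplex"
  assumes "n > 0"
    and "W_infty (n - 1) \<mu>"
    and "c > 0" and "c < 1"
    and "W_infty_norm (n - 1) \<mu> \<le> ereal c"
    and "beltrami_solution n \<mu> w"
  shows "\<exists>W :: nat \<Rightarrow> complex \<Rightarrow> bicomplex.
      (\<forall>k<n. weakly_differentiable (W k) \<and>
        (AE z in lebesgue_on unit_disk. bc_dbar (W k) z = \<mu> z * bc_d (W k) z)) \<and>
      (\<forall>z\<in>unit_disk. w z = (\<Sum>k<n. bc_hat (cnj z) ^ k * W k z))"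
proof -
  define F where "F k = (beltrami \<mu> ^^ k) w" for k
  \<comment> \<open>\<open>F (Suc k)\<close> is by definition \<open>beltrami \<mu> (F k)\<close>,
    so only weak differentiability has to be supplied.\<close>
  have F: "has_beltrami \<mu> (F k) (F (Suc k))" if "k < n" for k
    using assms(6) that by (simp add: has_beltrami_def F_def beltrami_solution_def)
  have Fn: "AE z in lebesgue_on unit_disk. F n z = 0"
    using assms(6) by (simp add: F_def beltrami_solution_def)
  define W where "W k z = (1 / fact k) *\<^sub>R
      (\<Sum>m<n - k. ((-1) ^ m / fact m) *\<^sub>R (bc_hat (cnj z) ^ m * F (k + m) z))" for k z
  have W: "has_beltrami \<mu> (W k) (\<lambda>_. 0)" if "k < n" for k
  proof -
    \<comment> \<open>This \<open>N\<close> is the last summation index in \<open>W k\<close>; the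
      term surviving the telescoping then contains \<open>F n\<close>, which is zero almost
      everywhere.\<close>
    obtain N where N: "n - k = Suc N" "Suc (k + N) = n"
      using \<open>k < n\<close> by (metis Suc_diff_Suc add_Suc_right add_diff_inverse_nat less_imp_not_less)
    let ?V = "\<lambda>z. (1 / fact k) *\<^sub>R (\<Sum>m<n - k. ((-1) ^ m / fact m) *\<^sub>R
      (of_nat m * bc_hat (cnj z) ^ (m - 1) * F (k + m) z + bc_hat (cnj z) ^ m * F (Suc (k + m)) z))"
    have "has_beltrami \<mu> (W k) ?V"
      unfolding W_def[abs_def]
      by (intro has_beltrami_scaleR has_beltrami_sum has_beltrami_mult_bc_hat_cnj_power F) auto
    moreover have "?V z = (1 / fact k) *\<^sub>R ((-1) ^ N / fact N) *\<^sub>R (bc_hat (cnj z) ^ N * F n z)" for z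
      unfolding N(1)
      using taylor_coefficients_telescope[of "bc_hat (cnj z)" "\<lambda>m. F (k + m) z" N, unfolded add_Suc_right N(2)]
      by (simp only:)
    ultimately have "weakly_differentiable (W k)" "AE z in lebesgue_on unit_disk. beltrami \<mu> (W k) z =
        (1 / fact k) *\<^sub>R ((-1) ^ N / fact N) *\<^sub>R (bc_hat (cnj z) ^ N * F n z)"
      by (simp_all only: has_beltrami_def)
    with Fn show ?thesis
      unfolding has_beltrami_def by (auto elim: eventually_elim2)
  qed
  have "weakly_differentiable (W k) \<and>
      (AE z in lebesgue_on unit_disk. bc_dbar (W k) z = \<mu> z * bc_d (W k) z)" if "k < n" for k
    using W[OF that] by (simp add: has_beltrami_def beltrami_def)
  \<comment> \<open>The expansion is an algebraic identity in the values \<open>F l z\<close> with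
    \<open>F 0 = w\<close>, so it holds at every point and not just almost everywhere.\<close>
  moreover have "w z = (\<Sum>k<n. bc_hat (cnj z) ^ k * W k z)" for z
    using taylor_reconstruction[OF \<open>n > 0\<close>, of "bc_hat (cnj z)" "\<lambda>l. F l z"]
    by (simp add: W_def F_def)
  ultimately show ?thesis by blast
qed

end
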